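(* Let $k$ be a field with $\mathrm{char}\,k\neq2$ and let $M\supset k$ be an infinite field. Let $m,n\in M$ with $m^2+3m+9\neq0$ and $n^2+3n+9\ne0$. Then the splitting fields over $M$ of $X^3-mX^2-(m+3)X-1$ and of $X^3-nX^2-(n+3)X-1$ coincide if and only if there exists $z\in M$ (with nonvanishing denominator below) such that either $$n=\frac{m(z^3-3z-1)-9z(z+1)}{mz(z+1)+z^3+3z^2-1}\quad\text{or}\quad n=-\frac{m(z^3+3z^2-1)+3(z^3-3z-1)}{mz(z+1)+z^3+3z^2-1}.$$
   Context: Splitting fields are taken in a fixed algebraic closure of $M$. The discriminant of $X^3-mX^2-(m+3)X-1$ is $(m^2+3m+9)^2$. *)

theory Defs
  imports "HOL-Algebra.Algebraic_Closure_Type" "HOL-Algebra.Generated_Fields"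
begin

text \<open>
  All fields live inside one ambient field, the type \<open>'a :: field\<close>, seen as a HOL-Algebra ring
  through \<^const>\<open>ring_of_type_algebra\<close>. An algebraic closure of \<open>M\<close> is thus rendered by
  \<open>algebraic_closure (ring_of_type_algebra :: 'a ring) M\<close>: the whole type is an algebraic closure
  of its subfield \<open>M\<close>. Every subfield shares the unit of \<open>'a\<close>, so its characteristic is
  \<open>CHAR('a)\<close>.
\<close>

text \<open>
  The subfield generated by \<open>M\<close> and by all roots of \<open>p\<close> in \<open>'a\<close>. It is the splitting field of
  \<open>p\<close> over \<open>M\<close> provided the coefficients of \<open>p\<close> are in \<open>M\<close> and \<open>p\<close> splits over \<open>'a\<close>.
\<close>
definition splitting_field :: "'a::field set \<Rightarrow> 'a poly \<Rightarrow> 'a set" where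
  "splitting_field M p = generate_field ring_of_type_algebra (M \<union> {x. poly p x = 0})"

text \<open>\<open>X\<^sup>3 - m X\<^sup>2 - (m + 3) X - 1\<close>; the list starts with the constant coefficient.\<close>
definition simplest_cubic :: "'a::field \<Rightarrow> 'a poly" where
  "simplest_cubic m = [:- 1, - (m + 3), - m, 1:]"

end

theory Submission
  imports Defs
begin

text \<open>
  If \<open>x\<close> is a root of the cubic with parameter \<open>m\<close>, the other two roots are \<open>- 1 / (1 + x)\<close> and
  \<open>- (1 + x) / x\<close>, so any root generates the splitting field. The Moebius maps
  \<open>y = (z x - 1) / (x + z + 1)\<close> commute with the order-three map \<open>x \<mapsto> - 1 / (1 + x)\<close>, and they turn
  roots for \<open>m\<close> into roots for the first value of \<open>n\<close> in the theorem. Replacing \<open>n\<close> by \<open>- n - 3\<close>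
  inverts the roots and exchanges the two formulas.

  Conversely, let \<open>x\<close> and \<open>y\<close> be roots generating the same field over \<open>M\<close>. Solving for \<open>z\<close> gives
  \<open>z = (y x + y + 1) / (x - y)\<close>. If the field is larger than \<open>M\<close>, the automorphism
  \<open>\<sigma> : x \<mapsto> - 1 / (1 + x)\<close> moves \<open>y\<close> to one of the two other roots; after replacing \<open>y\<close> by its inverse
  if necessary, \<open>\<sigma> y = - 1 / (1 + y)\<close>, and then \<open>z\<close> is fixed by \<open>\<sigma>\<close>, hence lies in \<open>M\<close>.
\<close>

section \<open>Subfields of the ambient field, and splitting fields\<close>

abbreviation ambient :: "'a::field ring" where
  "ambient \<equiv> ring_of_type_algebra"

lemma ambient_simps [simp]:
  "carrier (ambient :: 'a::field ring) = UNIV"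
  "(x :: 'a) \<oplus>\<^bsub>ambient\<^esub> y = x + y"
  "(x :: 'a) \<otimes>\<^bsub>ambient\<^esub> y = x * y"
  "\<zero>\<^bsub>ambient\<^esub> = (0 :: 'a)"
  "\<one>\<^bsub>ambient\<^esub> = (1 :: 'a)"
  by (simp_all add: ring_of_type_algebra_def)

lemma ambient_a_inv [simp]: "\<ominus>\<^bsub>ambient\<^esub> (x :: 'a::field) = - x"
proof -
  interpret ambient: field "ambient :: 'a ring" by (rule field_from_type_algebra)
  show ?thesis by (rule ambient.minus_equality) auto
qed

lemma ambient_m_inv [simp]: "(x :: 'a::field) \<noteq> 0 \<Longrightarrow> inv\<^bsub>ambient\<^esub> x = inverse x"
proof -
  interpret ambient: field "ambient :: 'a ring" by (rule field_from_type_algebra)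
  show "x \<noteq> 0 \<Longrightarrow> inv\<^bsub>ambient\<^esub> x = inverse x" by (rule ambient.inv_char) auto
qed

lemma subfield_ambientI:
  fixes F :: "'a::field set"
  assumes "1 \<in> F" "\<And>x. x \<in> F \<Longrightarrow> - x \<in> F"
    and "\<And>x y. x \<in> F \<Longrightarrow> y \<in> F \<Longrightarrow> x + y \<in> F"
    and "\<And>x y. x \<in> F \<Longrightarrow> y \<in> F \<Longrightarrow> x * y \<in> F"
    and "\<And>x. x \<in> F \<Longrightarrow> x \<noteq> 0 \<Longrightarrow> inverse x \<in> F"
  shows "subfield F ambient"
proof -
  interpret ambient: field "ambient :: 'a ring" by (rule field_from_type_algebra)
  show ?thesis by (rule ambient.subfieldI', rule ambient.subringI) (use assms in auto)
qed

locale ambient_subfield =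
  fixes F :: "'a::field set"
  assumes subfield: "subfield F ambient"
begin

lemma one_mem [simp]: "1 \<in> F"
  and add_mem [simp]: "x \<in> F \<Longrightarrow> y \<in> F \<Longrightarrow> x + y \<in> F"
  and mult_mem [simp]: "x \<in> F \<Longrightarrow> y \<in> F \<Longrightarrow> x * y \<in> F"
  and uminus_mem [simp]: "x \<in> F \<Longrightarrow> - x \<in> F"
  and zero_mem [simp]: "0 \<in> F"
  using subringE(2,3,5,6,7)[OF subfieldE(1)[OF subfield]] by auto

lemma inverse_mem [simp]: "x \<in> F \<Longrightarrow> inverse x \<in> F"
proof -
  interpret ambient: field "ambient :: 'a ring" by (rule field_from_type_algebra)
  show "x \<in> F \<Longrightarrow> inverse x \<in> F"
    using ambient.subfield_m_inv(1)[OF subfield, of x] by (cases "x = 0") auto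
qed

lemma diff_mem [simp]: "x \<in> F \<Longrightarrow> y \<in> F \<Longrightarrow> x - y \<in> F"
  using add_mem[of x "- y"] by simp

lemma divide_mem [simp]: "x \<in> F \<Longrightarrow> y \<in> F \<Longrightarrow> x / y \<in> F"
  by (simp add: divide_inverse)

lemma power_mem [simp]: "x \<in> F \<Longrightarrow> x ^ n \<in> F"
  by (induction n) auto

lemma of_nat_mem [simp]: "of_nat n \<in> F"
  by (induction n) auto

lemma numeral_mem [simp]: "numeral n \<in> F"
  using of_nat_mem[of "numeral n"] by simp

end

lemma splitting_field_subfield: "subfield (splitting_field M p) (ambient :: 'a::field ring)"
proof -
  interpret ambient: field "ambient :: 'a ring" by (rule field_from_type_algebra)
  show ?thesis
    unfolding splitting_field_def by (rule ambient.generate_field_is_subfield) simp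
qed

lemma subset_splitting_field: "M \<subseteq> splitting_field M p"
  and root_in_splitting_field: "poly p x = 0 \<Longrightarrow> x \<in> splitting_field M p"
  unfolding splitting_field_def by (auto intro: generate_field.incl)

lemma splitting_field_least:
  assumes "subfield F (ambient :: 'a::field ring)" "M \<subseteq> F" "\<And>x. poly p x = 0 \<Longrightarrow> x \<in> F"
  shows "splitting_field M p \<subseteq> F"
proof -
  interpret ambient: field "ambient :: 'a ring" by (rule field_from_type_algebra)
  show ?thesis
    unfolding splitting_field_def using assms
    by (intro ambient.generate_field_min_subfield1) auto
qed

section \<open>Roots of the simplest cubics\<close>

lemma poly_simplest_cubic:
  "poly (simplest_cubic m) x = x^3 - m * x^2 - (m + 3) * x - 1"
  by (simp add: simplest_cubic_def algebra_simps power2_eq_square power3_eq_cube)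

lemma simplest_cubic_has_root:
  assumes "algebraic_closure (ambient :: 'a::field ring) M"
  shows "\<exists>x::'a. poly (simplest_cubic m) x = 0"
proof -
  interpret ambient: algebraic_closure "ambient :: 'a ring" M by (fact assms)
  \<comment> \<open>HOL-Algebra lists start with the leading coefficient, the reverse of the order
    in \<open>simplest_cubic\<close>.\<close>
  let ?p = "[1, - m, - (m + 3), - 1] :: 'a list"
  have p: "?p \<in> carrier (poly_ring ambient)"
    by (simp add: univ_poly_carrier[symmetric] polynomial_def)
  have "size (ambient.roots ?p) = 3"
    using ambient.roots_over_carrier[OF p] by (simp add: ambient.splitted_def)
  then obtain x where "x \<in># ambient.roots ?p"
    by (metis size_empty multiset_nonemptyE zero_neq_numeral)
  then have "ambient.eval ?p x = 0"
    using ambient.roots_mem_iff_is_root[OF p] by (simp add: ambient.is_root_def)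
  then show ?thesis
    by (intro exI[of _ x]) (simp add: poly_simplest_cubic eval_nat_numeral algebra_simps)
qed

text \<open>The cubic takes the values \<open>- 1\<close> at \<open>0\<close> and \<open>1\<close>
  at \<open>- 1\<close>. This keeps the denominators of the conjugate roots nonzero.\<close>

lemma simplest_cubic_root_nonzero:
  assumes "poly (simplest_cubic m) x = 0"
  shows "x \<noteq> 0" "x + 1 \<noteq> 0" "1 + x \<noteq> 0"
proof -
  show "x \<noteq> 0" using assms by (auto simp: poly_simplest_cubic)
  have "poly (simplest_cubic m) (- 1) = 1" by (simp add: poly_simplest_cubic)
  then have "x \<noteq> - 1" using assms by auto
  then show "x + 1 \<noteq> 0" "1 + x \<noteq> 0"
    by (metis add_eq_0_iff2 add_eq_0_iff)+
qed

lemma simplest_cubic_root_iff: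
  "poly (simplest_cubic m) x = 0 \<longleftrightarrow> m * (x * (x + 1)) = x^3 - 3 * x - 1"
  by (auto simp: poly_simplest_cubic algebra_simps power2_eq_square)

(* The qualified name Groebner_Basis.algebra is needed because HOL-Algebra shadows algebra. *)
lemma simplest_cubic_roots:
  assumes "poly (simplest_cubic m) x = 0"
  shows "poly (simplest_cubic m) y = 0 \<longleftrightarrow> y = x \<or> y = - 1 / (1 + x) \<or> y = - (1 + x) / x"
proof -
  note nz = simplest_cubic_root_nonzero[OF assms]
  \<comment> \<open>The factorization into linear factors, cleared of denominators; modulo the
    equation of \<open>x\<close>, each factor vanishes at one of the three roots.\<close>
  have "(x * (1 + x)) * poly (simplest_cubic m) y = (y - x) * ((1 + x) * y + 1) * (x * y + (1 + x))"
    using assms unfolding poly_simplest_cubic by Groebner_Basis.algebra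
  then have "poly (simplest_cubic m) y = 0 \<longleftrightarrow>
      y - x = 0 \<or> (1 + x) * y + 1 = 0 \<or> x * y + (1 + x) = 0"
    using nz by (metis mult_eq_0_iff)
  moreover have "(1 + x) * y + 1 = 0 \<longleftrightarrow> y = - 1 / (1 + x)"
    using nz by (auto simp: field_simps add_eq_0_iff)
  moreover have "x * y + (1 + x) = 0 \<longleftrightarrow> y = - (1 + x) / x"
    using nz by (auto simp: field_simps add_eq_0_iff)
  ultimately show ?thesis by simp
qed

text \<open>Reversing the coefficients of the cubic for \<open>m\<close> gives, up to sign, the
  cubic for \<open>- m - 3\<close>.\<close>

lemma simplest_cubic_root_inverse:
  assumes "poly (simplest_cubic m) x = 0"
  shows "poly (simplest_cubic (- m - 3)) (inverse x) = 0"
proof -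
  have "x \<noteq> 0" using simplest_cubic_root_nonzero[OF assms] by simp
  moreover have "x^3 * poly (simplest_cubic (- m - 3)) (inverse x) = - poly (simplest_cubic m) x"
    using \<open>x \<noteq> 0\<close> unfolding poly_simplest_cubic
    by (simp add: field_simps power2_eq_square power3_eq_cube)
  ultimately show ?thesis using assms by simp
qed

text \<open>Otherwise \<open>m = 3 * x\<close>, and then
  \<open>m^2 + 3 * m + 9 = 9 * (x^2 + x + 1) = 0\<close>.\<close>

lemma simplest_cubic_root_no_cube_root_of_unity:
  assumes "poly (simplest_cubic m) x = 0" "m^2 + 3 * m + 9 \<noteq> 0"
  shows "x^2 + x + 1 \<noteq> 0"
proof
  assume x: "x^2 + x + 1 = 0"
  then have "m = 3 * x"
    using assms(1) unfolding poly_simplest_cubic by Groebner_Basis.algebra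
  then show False using x assms(2) by Groebner_Basis.algebra
qed

text \<open>The other two roots are rational expressions in \<open>x\<close>, so a field over
  \<open>M\<close> contains all roots as soon as it contains one.\<close>

lemma splitting_field_simplest_cubic_subset_iff:
  assumes "subfield F ambient" "M \<subseteq> F" "poly (simplest_cubic m) x = 0"
  shows "splitting_field M (simplest_cubic m) \<subseteq> F \<longleftrightarrow> x \<in> F"
proof
  interpret ambient_subfield F by (rule ambient_subfield.intro) (fact assms(1))
  assume "x \<in> F"
  then show "splitting_field M (simplest_cubic m) \<subseteq> F"
    using simplest_cubic_roots[OF assms(3)] assms(1,2)
    by (intro splitting_field_least) auto
next
  assume "splitting_field M (simplest_cubic m) \<subseteq> F"
  then show "x \<in> F" using root_in_splitting_field[OF assms(3)] by auto
qed

lemma splitting_field_simplest_cubic_reflect: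
  assumes "poly (simplest_cubic m) x = 0"
  shows "splitting_field M (simplest_cubic (- m - 3)) = splitting_field M (simplest_cubic m)"
proof
  let ?L = "splitting_field M (simplest_cubic m)"
  let ?L' = "splitting_field M (simplest_cubic (- m - 3))"
  interpret L: ambient_subfield ?L by (rule ambient_subfield.intro) (rule splitting_field_subfield)
  interpret L': ambient_subfield ?L' by (rule ambient_subfield.intro) (rule splitting_field_subfield)
  note inv = simplest_cubic_root_inverse[OF assms]
  show "?L' \<subseteq> ?L"
    using splitting_field_simplest_cubic_subset_iff[OF L.subfield subset_splitting_field inv]
      root_in_splitting_field[OF assms] by simp
  have "x \<in> ?L'"
    using L'.inverse_mem[OF root_in_splitting_field[OF inv]] by simp
  then show "?L \<subseteq> ?L'"
    using splitting_field_simplest_cubic_subset_iff[OF L'.subfield subset_splitting_field assms] by simp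
qed

section \<open>Moebius maps between roots of different cubics\<close>

text \<open>With \<open>y = P / Q\<close>, the right-hand sides are \<open>y * (y + 1)\<close> and
  \<open>y^3 - 3 * y - 1\<close> times \<open>Q^3\<close>. Their quotient is the parameter of the
  cubic with root \<open>y\<close>, so the left-hand sides give the first formula for
  \<open>n\<close>.\<close>

lemma transformed_numerator_denominator:
  fixes m x z :: "'a::field"
  assumes "poly (simplest_cubic m) x = 0"
  defines "P \<equiv> z * x - 1" and "Q \<equiv> x + z + 1"
  shows "(m * z * (z + 1) + z^3 + 3 * z^2 - 1) * (x * (x + 1)) = P * Q * (P + Q)"
    and "(m * (z^3 - 3 * z - 1) - 9 * z * (z + 1)) * (x * (x + 1)) = P^3 - 3 * P * Q^2 - Q^3"
  using assms(1) unfolding poly_simplest_cubic P_def Q_def by (Groebner_Basis.algebra, Groebner_Basis.algebra)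

text \<open>The first formula for \<open>n\<close>, cleared of denominators; the second one relates \<open>m\<close> to \<open>- n - 3\<close>.\<close>
definition moebius_related :: "'a::field set \<Rightarrow> 'a \<Rightarrow> 'a \<Rightarrow> bool" where
  "moebius_related M m n \<longleftrightarrow> (\<exists>z\<in>M. m * z * (z + 1) + z^3 + 3 * z^2 - 1 \<noteq> 0 \<and>
     n * (m * z * (z + 1) + z^3 + 3 * z^2 - 1) = m * (z^3 - 3 * z - 1) - 9 * z * (z + 1))"

text \<open>The Moebius image \<open>y\<close> of \<open>x\<close> is a root for \<open>n\<close>.
  The map has coefficients in \<open>M\<close> and is invertible, so \<open>x\<close> and
  \<open>y\<close> generate the same field over \<open>M\<close>.\<close>

lemma moebius_related_splitting_field:
  assumes "subfield M ambient" "poly (simplest_cubic m) x = 0" "n^2 + 3 * n + 9 \<noteq> 0"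
    and "moebius_related M m n"
  shows "splitting_field M (simplest_cubic m) = splitting_field M (simplest_cubic n)"
proof -
  let ?L = "splitting_field M (simplest_cubic m)" and ?L' = "splitting_field M (simplest_cubic n)"
  interpret M: ambient_subfield M by (rule ambient_subfield.intro) (fact assms(1))
  interpret L: ambient_subfield ?L by (rule ambient_subfield.intro) (rule splitting_field_subfield)
  interpret L': ambient_subfield ?L' by (rule ambient_subfield.intro) (rule splitting_field_subfield)
  obtain z where z: "z \<in> M"
    and D: "m * z * (z + 1) + z^3 + 3 * z^2 - 1 \<noteq> 0"
    and n: "n * (m * z * (z + 1) + z^3 + 3 * z^2 - 1) = m * (z^3 - 3 * z - 1) - 9 * z * (z + 1)"
    using assms(4) unfolding moebius_related_def by blast
  define P Q where "P = z * x - 1" and "Q = x + z + 1"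
  note id = transformed_numerator_denominator[OF assms(2), of z, folded P_def Q_def]
  have "P * Q * (P + Q) \<noteq> 0"
    using id(1) D simplest_cubic_root_nonzero[OF assms(2)] by (metis mult_eq_0_iff)
  then have Q: "Q \<noteq> 0" by auto
  define y where "y = P / Q"
  have y: "y * Q = P" using Q by (simp add: y_def)
  have "n * (P * Q * (P + Q)) = P^3 - 3 * P * Q^2 - Q^3"
    using id n by Groebner_Basis.algebra
  then have "Q^3 * (n * (y * (y + 1)) - (y^3 - 3 * y - 1)) = 0"
    unfolding y[symmetric] by Groebner_Basis.algebra
  then have root: "poly (simplest_cubic n) y = 0"
    using Q by (simp add: simplest_cubic_root_iff)
  \<comment> \<open>The map has determinant \<open>z^2 + z + 1\<close>, which vanishes if
    \<open>z = y\<close>. Then \<open>n = 3 * z\<close>, which makes \<open>n^2 + 3 * n + 9\<close>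
    vanish.\<close>
  have "z \<noteq> y"
  proof
    assume "z = y"
    then have "z * (x + z + 1) = z * x - 1" using y by (simp add: P_def Q_def)
    then have "z^2 + z + 1 = 0" by Groebner_Basis.algebra
    then have "(n - 3 * z) * (m * z * (z + 1) + z^3 + 3 * z^2 - 1) = 0" using n by Groebner_Basis.algebra
    then have "n = 3 * z" using D by simp
    then show False using \<open>z^2 + z + 1 = 0\<close> assms(3) by Groebner_Basis.algebra
  qed
  moreover have "x * (z - y) = (z + 1) * y + 1"
    using y unfolding P_def Q_def by Groebner_Basis.algebra
  ultimately have x: "x = ((z + 1) * y + 1) / (z - y)"
    by (simp add: field_simps)
  have "z \<in> ?L" "z \<in> ?L'" using z subset_splitting_field by blast+
  have "x \<in> ?L'" "y \<in> ?L"
  proof -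
    show "x \<in> ?L'"
      unfolding x using \<open>z \<in> ?L'\<close> root_in_splitting_field[OF root, of M] by simp
    show "y \<in> ?L"
      using \<open>z \<in> ?L\<close> root_in_splitting_field[OF assms(2), of M] by (simp add: y_def P_def Q_def)
  qed
  then show ?thesis
    using splitting_field_simplest_cubic_subset_iff[OF L.subfield subset_splitting_field root]
      splitting_field_simplest_cubic_subset_iff[OF L'.subfield subset_splitting_field assms(2)]
    by auto
qed

text \<open>The quotient in the last assumption is the solution \<open>z\<close> of
  \<open>y = (z * x - 1) / (x + z + 1)\<close>.\<close>

lemma moebius_relatedI:
  assumes "poly (simplest_cubic m) x = 0" "poly (simplest_cubic n) y = 0"
    and "m^2 + 3 * m + 9 \<noteq> 0" "0 \<in> M"
    and "x \<noteq> y \<Longrightarrow> (y * x + y + 1) / (x - y) \<in> M"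
  shows "moebius_related M m n"
proof (cases "x = y")
  case True
  have "m * (x * (x + 1)) = n * (x * (x + 1))"
    using assms(1,2) True by (simp add: simplest_cubic_root_iff)
  then have "m = n" using simplest_cubic_root_nonzero[OF assms(1)] by simp
  \<comment> \<open>Equality of the roots corresponds to \<open>z\<close> at infinity. The witness
    \<open>0\<close> serves instead: its map \<open>x -> - 1 / (x + 1)\<close> permutes the roots,
    and the denominator is \<open>- 1\<close>.\<close>
  then show ?thesis
    unfolding moebius_related_def using \<open>0 \<in> M\<close> by (intro bexI[of _ 0]) auto
next
  case False
  define z where "z = (y * x + y + 1) / (x - y)"
  define P Q where "P = z * x - 1" and "Q = x + z + 1"
  let ?D = "m * z * (z + 1) + z^3 + 3 * z^2 - 1"
  let ?N = "m * (z^3 - 3 * z - 1) - 9 * z * (z + 1)"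
  note id = transformed_numerator_denominator[OF assms(1), of z, folded P_def Q_def]
  have xx: "x^2 + x + 1 \<noteq> 0"
    using simplest_cubic_root_no_cube_root_of_unity[OF assms(1,3)] .
  have z: "z * (x - y) = y * x + y + 1" using False by (simp add: z_def)
  then have P: "P = y * Q" unfolding P_def Q_def by Groebner_Basis.algebra
  have "Q * (x - y) = x^2 + x + 1" unfolding Q_def using z by Groebner_Basis.algebra
  then have Q: "Q \<noteq> 0" using xx by auto
  have "?D * (x * (x + 1)) = y * (y + 1) * Q^3"
    unfolding id P by Groebner_Basis.algebra
  then have D: "?D \<noteq> 0"
    using Q simplest_cubic_root_nonzero[OF assms(2)] by auto
  have "(n * ?D - ?N) * (x * (x + 1)) = 0"
    using id assms(2)[unfolded simplest_cubic_root_iff] P by Groebner_Basis.algebra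
  then have "n * ?D = ?N" using simplest_cubic_root_nonzero[OF assms(1)] by simp
  then show ?thesis
    unfolding moebius_related_def using D assms(5)[OF False, folded z_def] by blast
qed

section \<open>Coordinates with respect to the powers of a root\<close>

text \<open>The coefficients are kept apart from \<open>t\<close> so that the same triple can be
  evaluated at two conjugate roots.\<close>

definition quad :: "'a::field \<Rightarrow> 'a \<Rightarrow> 'a \<Rightarrow> 'a \<Rightarrow> 'a" where
  "quad a b c t = a + b * t + c * t^2"

text \<open>Reduction by \<open>t^3 = m * t^2 + (m + 3) * t + 1\<close> and the resulting formula
  for \<open>t^4\<close>. The new coefficients do not depend on the choice of the root
  \<open>t\<close>, which makes \<open>sigma\<close> multiplicative.\<close>

lemma quad_mult:
  assumes "poly (simplest_cubic m) t = 0"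
  shows "quad a b c t * quad d e f t =
    quad (a * d + (b * f + c * e) + c * f * m)
      (a * e + b * d + (b * f + c * e) * (m + 3) + c * f * (m^2 + 3 * m + 1))
      (a * f + b * e + c * d + (b * f + c * e) * m + c * f * (m^2 + m + 3)) t"
  using assms unfolding poly_simplest_cubic quad_def by Groebner_Basis.algebra

text \<open>Division with remainder: \<open>(1 + t) * (t^2 - (m + 1) * t - 2)\<close> is the cubic
  minus \<open>1\<close>.\<close>

lemma root_shift_eq_quad:
  assumes "poly (simplest_cubic m) t = 0"
  shows "- 1 / (1 + t) = quad (- 2) (- (m + 1)) 1 t"
proof -
  have "quad (- 2) (- (m + 1)) 1 t * (1 + t) = - 1"
    using assms unfolding poly_simplest_cubic quad_def by Groebner_Basis.algebra
  then show ?thesis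
    using simplest_cubic_root_nonzero[OF assms] by (metis nonzero_eq_divide_eq)
qed

section \<open>The cyclic cubic extension generated by a root outside \<open>M\<close>\<close>

locale simplest_cubic_extension = ambient_subfield M for M :: "'a::field set" +
  fixes m x :: 'a
  assumes m_mem [simp]: "m \<in> M"
    and root: "poly (simplest_cubic m) x = 0"
    and x_not_mem: "x \<notin> M"
    and disc_nonzero: "m^2 + 3 * m + 9 \<noteq> 0"
begin

definition "x' = - 1 / (1 + x)"

lemma root': "poly (simplest_cubic m) x' = 0"
  using simplest_cubic_roots[OF root, of x'] by (simp add: x'_def)

lemma linear_independent2:
  assumes "a \<in> M" "b \<in> M" "a + b * x = 0"
  shows "a = 0 \<and> b = 0"
proof (cases "b = 0")
  case False
  then have "x = - a / b" using assms(3) by (simp add: field_simps add_eq_0_iff)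
  then show ?thesis using assms x_not_mem by (metis divide_mem uminus_mem)
qed (use assms in auto)

lemma no_root_in_base:
  assumes "poly (simplest_cubic m) y = 0"
  shows "y \<notin> M"
proof
  assume "y \<in> M"
  then show False
    using simplest_cubic_roots[OF assms, of x] root x_not_mem by auto
qed

text \<open>The cubic has no root in \<open>M\<close>, so a quadratic relation for \<open>x\<close>
  cannot split off a linear factor.\<close>

lemma linear_independent3:
  assumes "a \<in> M" "b \<in> M" "c \<in> M" "quad a b c x = 0"
  shows "a = 0 \<and> b = 0 \<and> c = 0"
proof (cases "c = 0")
  case True
  then show ?thesis using linear_independent2[of a b] assms by (simp add: quad_def)
next
  case False
  define p q where "p = - b / c" and "q = - a / c"
  have mem: "p \<in> M" "q \<in> M" using assms by (simp_all add: p_def q_def)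
  have "c * (x^2 - p * x - q) = quad a b c x"
    using False by (simp add: p_def q_def quad_def field_simps)
  then have "x^2 - p * x - q = 0" using False assms(4) by (metis mult_eq_0_iff)
  then have x2: "x^2 = p * x + q" by (simp add: algebra_simps)
  \<comment> \<open>The remainder of the cubic modulo \<open>X^2 - p * X - q\<close>, evaluated at
    \<open>x\<close>.\<close>
  have "(p * q - m * q - 1) + (p^2 + q - m * p - m - 3) * x = 0"
    using x2 root unfolding poly_simplest_cubic by Groebner_Basis.algebra
  then have pq: "p * q - m * q - 1 = 0" "p^2 + q - m * p - m - 3 = 0"
    using linear_independent2[of "p * q - m * q - 1" "p^2 + q - m * p - m - 3"] mem by auto
  txt \<open>Hence \<open>X\<^sup>2 - p X - q\<close> divides the cubic, and the remaining root is \<open>m - p\<close>.\<close>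
  have "poly (simplest_cubic m) (m - p) = 0"
    using pq unfolding poly_simplest_cubic by Groebner_Basis.algebra
  then show ?thesis using no_root_in_base diff_mem[OF m_mem mem(1)] by blast
qed

definition K :: "'a set" where
  "K = {quad a b c x | a b c. a \<in> M \<and> b \<in> M \<and> c \<in> M}"

text \<open>The automorphism of \<open>K\<close> over \<open>M\<close> sending \<open>x\<close> to
  \<open>x'\<close>. Independence of the powers of \<open>x\<close> makes the description unique on
  \<open>K\<close>; outside \<open>K\<close> the value is unspecified.\<close>

definition sigma :: "'a \<Rightarrow> 'a" where
  "sigma u = (THE v. \<exists>a\<in>M. \<exists>b\<in>M. \<exists>c\<in>M. u = quad a b c x \<and> v = quad a b c x')"

lemma quad_mem [simp]: "a \<in> M \<Longrightarrow> b \<in> M \<Longrightarrow> c \<in> M \<Longrightarrow> quad a b c x \<in> K"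
  unfolding K_def by blast

lemma K_cases:
  assumes "u \<in> K"
  obtains a b c where "a \<in> M" "b \<in> M" "c \<in> M" "u = quad a b c x"
  using assms unfolding K_def by blast

lemma sigma_quad [simp]:
  assumes "a \<in> M" "b \<in> M" "c \<in> M"
  shows "sigma (quad a b c x) = quad a b c x'"
  unfolding sigma_def
proof (rule the_equality)
  fix v
  assume "\<exists>d\<in>M. \<exists>e\<in>M. \<exists>f\<in>M. quad a b c x = quad d e f x \<and> v = quad d e f x'"
  then obtain d e f where M: "d \<in> M" "e \<in> M" "f \<in> M"
    and eq: "quad a b c x = quad d e f x" and v: "v = quad d e f x'"
    by blast
  have "quad (a - d) (b - e) (c - f) x = 0"
    using eq by (simp add: quad_def algebra_simps)
  then show "v = quad a b c x'"
    using linear_independent3[of "a - d" "b - e" "c - f"] M assms v by simp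
qed (use assms in blast)

lemma base_mem_K: "u \<in> M \<Longrightarrow> u \<in> K"
  and sigma_base: "u \<in> M \<Longrightarrow> sigma u = u"
  using quad_mem[of u 0 0] sigma_quad[of u 0 0] by (auto simp: quad_def)

lemma x_mem_K: "x \<in> K" and sigma_x: "sigma x = x'"
  using quad_mem[of 0 1 0] sigma_quad[of 0 1 0] by (auto simp: quad_def)

lemma add_mem_K: "u \<in> K \<Longrightarrow> v \<in> K \<Longrightarrow> u + v \<in> K"
  and sigma_add: "u \<in> K \<Longrightarrow> v \<in> K \<Longrightarrow> sigma (u + v) = sigma u + sigma v"
proof -
  assume "u \<in> K" "v \<in> K"
  then obtain a b c d e f where M: "a \<in> M" "b \<in> M" "c \<in> M" "d \<in> M" "e \<in> M" "f \<in> M"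
    and uv: "u = quad a b c x" "v = quad d e f x"
    by (elim K_cases) blast
  have add: "quad a b c t + quad d e f t = quad (a + d) (b + e) (c + f) t" for t
    by (simp add: quad_def algebra_simps)
  show "u + v \<in> K" "sigma (u + v) = sigma u + sigma v"
    using M by (simp_all add: uv add)
qed

lemma mult_mem_K: "u \<in> K \<Longrightarrow> v \<in> K \<Longrightarrow> u * v \<in> K"
  and sigma_mult: "u \<in> K \<Longrightarrow> v \<in> K \<Longrightarrow> sigma (u * v) = sigma u * sigma v"
proof -
  assume "u \<in> K" "v \<in> K"
  then obtain a b c d e f where M: "a \<in> M" "b \<in> M" "c \<in> M" "d \<in> M" "e \<in> M" "f \<in> M"
    and uv: "u = quad a b c x" "v = quad d e f x"
    by (elim K_cases) blast
  show "u * v \<in> K" "sigma (u * v) = sigma u * sigma v"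
    using M by (simp_all add: uv quad_mult[OF root] quad_mult[OF root'])
qed

lemma uminus_mem_K: "u \<in> K \<Longrightarrow> - u \<in> K"
  and sigma_uminus: "u \<in> K \<Longrightarrow> sigma (- u) = - sigma u"
  using mult_mem_K[of "- 1" u] sigma_mult[of "- 1" u] base_mem_K[of "- 1"] sigma_base[of "- 1"]
  by auto

lemma x'_eq_quad: "x' = quad (- 2) (- (m + 1)) 1 x"
  unfolding x'_def by (rule root_shift_eq_quad[OF root])

lemma x'_mem_K: "x' \<in> K"
  unfolding x'_eq_quad by (rule quad_mem) auto

lemma sigma_x': "sigma x' = - 1 / (1 + x')"
proof -
  have "sigma x' = quad (- 2) (- (m + 1)) 1 x'"
    by (subst x'_eq_quad) (rule sigma_quad, auto)
  then show ?thesis using root_shift_eq_quad[OF root'] by simp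
qed

lemma sigma_mem_K:
  assumes "u \<in> K"
  shows "sigma u \<in> K"
proof -
  obtain a b c where "a \<in> M" "b \<in> M" "c \<in> M" and u: "u = quad a b c x"
    using K_cases[OF assms] .
  then have "sigma u = quad a b c x'" by simp
  also have "\<dots> = a + b * x' + c * (x' * x')" by (simp add: quad_def power2_eq_square)
  finally have "sigma u = a + b * x' + c * (x' * x')" .
  then show ?thesis
    using \<open>a \<in> M\<close> \<open>b \<in> M\<close> \<open>c \<in> M\<close> by (simp add: add_mem_K mult_mem_K base_mem_K x'_mem_K)
qed

lemma sigma_quad_of_mem:
  assumes "a \<in> M" "b \<in> M" "c \<in> M" "t \<in> K"
  shows "sigma (quad a b c t) = quad a b c (sigma t)"
  using assms unfolding quad_def power2_eq_square
  by (simp add: sigma_add sigma_mult sigma_base add_mem_K mult_mem_K base_mem_K)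

text \<open>The map \<open>t -> - 1 / (1 + t)\<close> has order three, and it suffices to check the
  claim at the generator \<open>x\<close>.\<close>

lemma sigma_sigma_sigma:
  assumes "u \<in> K"
  shows "sigma (sigma (sigma u)) = u"
proof -
  obtain a b c where M: "a \<in> M" "b \<in> M" "c \<in> M" and u: "u = quad a b c x"
    using K_cases[OF assms] .
  define y where "y = sigma x'"
  note nz = simplest_cubic_root_nonzero[OF root] simplest_cubic_root_nonzero[OF root']
  have xy: "x' * (1 + x) = - 1" "y * (1 + x') = - 1"
    using nz by (simp_all add: y_def sigma_x') (simp add: x'_def)
  have "y \<in> K" unfolding y_def by (rule sigma_mem_K[OF x'_mem_K])
  have "sigma (y * (1 + x')) = sigma (- 1)" using xy by simp
  then have "sigma y * (1 + y) = - 1"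
    using \<open>y \<in> K\<close> by (simp add: sigma_mult sigma_add sigma_base add_mem_K base_mem_K x'_mem_K y_def)
  \<comment> \<open>The three-step cycle \<open>x\<close>, \<open>x'\<close>, \<open>y\<close>,
    \<open>sigma y\<close> closes up, once denominators are cleared.\<close>
  then have "(sigma y - x) * (1 + y) * (1 + x') * (1 + x) = 0"
    using xy by Groebner_Basis.algebra
  moreover have "1 + y \<noteq> 0" using \<open>sigma y * (1 + y) = - 1\<close> by auto
  ultimately have "sigma y = x" using nz by simp
  then show ?thesis
    using M by (simp add: u sigma_quad_of_mem x'_mem_K sigma_mem_K y_def)
qed

text \<open>A fixed point of \<open>t -> - 1 / (1 + t)\<close> is a zero of
  \<open>t^2 + t + 1\<close>, which the condition on \<open>m\<close> excludes.\<close>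

lemma x_neq_x': "x \<noteq> x'"
proof
  assume "x = x'"
  then have "x * (1 + x) = - 1"
    using simplest_cubic_root_nonzero[OF root] unfolding x'_def by (metis nonzero_eq_divide_eq)
  then have "x^2 + x + 1 = 0" by Groebner_Basis.algebra
  then show False
    using simplest_cubic_root_no_cube_root_of_unity[OF root disc_nonzero] by simp
qed

lemma sigma_fixed_mem:
  assumes "u \<in> K" "sigma u = u"
  shows "u \<in> M"
proof -
  obtain a b c where M: "a \<in> M" "b \<in> M" "c \<in> M" and u: "u = quad a b c x"
    using K_cases[OF assms(1)] .
  have "quad a b c x' = quad a b c x" using assms(2) M by (simp add: u)
  then have "(x - x') * (b + c * (x + x')) = 0" by (simp add: quad_def algebra_simps power2_eq_square)
  then have "b + c * (x + x') = 0" using x_neq_x' by simp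
  \<comment> \<open>Here \<open>x + x' = x^2 - m * x - 2\<close> turns the relation into one between
    \<open>1\<close>, \<open>x\<close> and \<open>x^2\<close>.\<close>
  then have "quad (b - 2 * c) (- m * c) c x = 0"
    by (simp add: x'_eq_quad quad_def algebra_simps)
  then have "b - 2 * c = 0 \<and> - m * c = 0 \<and> c = 0" using M by (intro linear_independent3) auto
  then show ?thesis using M by (simp add: u quad_def)
qed

text \<open>The norm \<open>u * sigma u * sigma (sigma u)\<close> is fixed by \<open>sigma\<close>,
  so it lies in \<open>M\<close> and can be inverted there.\<close>

lemma inverse_mem_K:
  assumes "u \<in> K" "u \<noteq> 0"
  shows "inverse u \<in> K"
proof -
  define v where "v = sigma u * sigma (sigma u)"
  have K: "sigma u \<in> K" "sigma (sigma u) \<in> K" "v \<in> K"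
    unfolding v_def using assms(1) by (simp_all add: sigma_mem_K mult_mem_K)
  have "u * v \<in> M"
    using assms(1) K by (intro sigma_fixed_mem)
      (simp_all add: mult_mem_K sigma_mult v_def sigma_sigma_sigma)
  have "sigma w \<noteq> 0" if "w \<in> K" "w \<noteq> 0" for w
    using sigma_sigma_sigma[of w] that sigma_base[of 0] by auto
  then have "u * v \<noteq> 0" using assms K by (simp add: v_def)
  moreover have "v * inverse (u * v) \<in> K"
    by (rule mult_mem_K[OF K(3) base_mem_K]) (rule inverse_mem, fact)
  moreover have "v * inverse (u * v) = inverse u" if "u * v \<noteq> 0"
    using that by (simp add: field_simps)
  ultimately show ?thesis by metis
qed

lemma subfield_K: "subfield K ambient"
  by (rule subfield_ambientI)
    (simp_all add: inverse_mem_K add_mem_K mult_mem_K uminus_mem_K base_mem_K)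

lemma splitting_field_subset_K: "splitting_field M (simplest_cubic m) \<subseteq> K"
  using splitting_field_simplest_cubic_subset_iff[OF subfield_K _ root] base_mem_K x_mem_K by blast

lemma sigma_divide:
  assumes "u \<in> K" "v \<in> K" "v \<noteq> 0"
  shows "sigma (u / v) = sigma u / sigma v"
proof -
  interpret K: ambient_subfield K by (rule ambient_subfield.intro) (rule subfield_K)
  have "sigma v \<noteq> 0" using sigma_sigma_sigma[of v] assms sigma_base[of 0] by auto
  moreover have "sigma (u / v) * sigma v = sigma (u / v * v)"
    using assms by (simp add: sigma_mult del: times_divide_eq_left)
  ultimately show ?thesis using assms by (simp add: field_simps)
qed

section \<open>From equal splitting fields to the parameter \<open>z\<close>\<close>

text \<open>Under \<open>sigma\<close>, numerator and denominator of \<open>z\<close> are both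
  divided by \<open>(1 + x) * (1 + y)\<close>, so the quotient is fixed.\<close>

lemma moebius_related_if_sigma_eq:
  assumes "poly (simplest_cubic n) y = 0" "y \<in> K" "sigma y = - 1 / (1 + y)"
  shows "moebius_related M m n"
proof (rule moebius_relatedI[OF root assms(1) disc_nonzero])
  interpret K: ambient_subfield K by (rule ambient_subfield.intro) (rule subfield_K)
  assume neq: "x \<noteq> y"
  note nz = simplest_cubic_root_nonzero[OF root] simplest_cubic_root_nonzero[OF assms(1)]
  have mem: "y * x + y + 1 \<in> K" "x - y \<in> K"
    using assms(2) x_mem_K by simp_all
  have "sigma (x - y) = sigma x - sigma y"
    using sigma_add[of x "- y"] sigma_uminus[of y] assms(2) x_mem_K by simp
  also have "\<dots> = (x - y) / ((1 + x) * (1 + y))"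
    using nz unfolding sigma_x assms(3) x'_def by (simp add: divide_simps; simp add: algebra_simps)
  finally have den: "sigma (x - y) = (x - y) / ((1 + x) * (1 + y))" .
  have "sigma (y * x + y + 1) = sigma y * sigma x + sigma y + 1"
    using assms(2) x_mem_K by (simp add: sigma_add sigma_mult sigma_base)
  also have "\<dots> = (y * x + y + 1) / ((1 + x) * (1 + y))"
    using nz unfolding sigma_x assms(3) x'_def by (simp add: divide_simps; simp add: algebra_simps)
  finally have num: "sigma (y * x + y + 1) = (y * x + y + 1) / ((1 + x) * (1 + y))" .
  have "sigma ((y * x + y + 1) / (x - y)) = (y * x + y + 1) / (x - y)"
    using neq nz by (subst sigma_divide[OF mem]) (simp_all add: num den)
  then show "(y * x + y + 1) / (x - y) \<in> M"
    using mem by (intro sigma_fixed_mem) simp_all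
qed simp

lemma moebius_related_or_reflected:
  assumes "n \<in> M" "poly (simplest_cubic n) y = 0" "y \<in> K" "y \<notin> M"
  shows "moebius_related M m n \<or> moebius_related M m (- n - 3)"
proof -
  interpret K: ambient_subfield K by (rule ambient_subfield.intro) (rule subfield_K)
  note nz = simplest_cubic_root_nonzero[OF assms(2)]
  \<comment> \<open>The equation of \<open>y\<close> is written with sums and products only, so that
    \<open>sigma\<close> can be pushed through it.\<close>
  have y: "n * (y * (y + 1)) + 3 * y + 1 = y * (y * y)"
    using assms(2) unfolding poly_simplest_cubic by Groebner_Basis.algebra
  then have "sigma (n * (y * (y + 1)) + 3 * y + 1) = sigma (y * (y * y))" by simp
  then have "n * (sigma y * (sigma y + 1)) + 3 * sigma y + 1 = sigma y * (sigma y * sigma y)"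
    using assms(1,3) by (simp add: sigma_add sigma_mult sigma_base base_mem_K)
  then have "poly (simplest_cubic n) (sigma y) = 0"
    unfolding poly_simplest_cubic by Groebner_Basis.algebra
  moreover have "sigma y \<noteq> y" using sigma_fixed_mem assms(3,4) by blast
  ultimately consider "sigma y = - 1 / (1 + y)" | "sigma y = - (1 + y) / y"
    using simplest_cubic_roots[OF assms(2)] by blast
  then show ?thesis
  proof cases
    case 1
    then show ?thesis using moebius_related_if_sigma_eq[OF assms(2,3)] by simp
  next
    \<comment> \<open>Here \<open>sigma\<close> acts on \<open>y\<close> by the inverse of the
      order-three map. Passing to \<open>inverse y\<close>, a root for \<open>- n - 3\<close>,
      restores the first case.\<close>
    case 2
    have "sigma (inverse y) = 1 / sigma y"
      using sigma_divide[of 1 y] assms(3) nz by (simp add: inverse_eq_divide sigma_base)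
    also have "sigma y = - (1 + inverse y)"
      using nz by (simp add: 2 field_simps)
    also have "1 / - (1 + inverse y) = - 1 / (1 + inverse y)"
      by (metis divide_minus_right minus_divide_left)
    finally show ?thesis
      using moebius_related_if_sigma_eq[OF simplest_cubic_root_inverse[OF assms(2)]] assms(3) by simp
  qed
qed

end

lemma splitting_field_eq_imp_moebius_related:
  assumes "subfield M (ambient :: 'a::field ring)" "m \<in> M" "n \<in> M"
    and "m^2 + 3 * m + 9 \<noteq> 0"
    and "poly (simplest_cubic m) x = 0" "poly (simplest_cubic n) y = 0"
    and "splitting_field M (simplest_cubic m) = splitting_field M (simplest_cubic n)"
  shows "moebius_related M m n \<or> moebius_related M m (- n - 3)"
proof -
  interpret ambient_subfield M by (rule ambient_subfield.intro) (fact assms(1))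
  have "x \<in> M \<longleftrightarrow> y \<in> M"
    using splitting_field_simplest_cubic_subset_iff[OF assms(1) order_refl assms(5)]
      splitting_field_simplest_cubic_subset_iff[OF assms(1) order_refl assms(6)] assms(7)
    by simp
  show ?thesis
  proof (cases "x \<in> M")
    \<comment> \<open>Both roots lie in \<open>M\<close>, so \<open>z\<close> does too, without any
      automorphism.\<close>
    case True
    then have "moebius_related M m n"
      using \<open>x \<in> M \<longleftrightarrow> y \<in> M\<close> by (intro moebius_relatedI[OF assms(5,6,4)]) simp_all
    then show ?thesis ..
  next
    case False
    interpret simplest_cubic_extension M m x
      by (intro simplest_cubic_extension.intro simplest_cubic_extension_axioms.intro
        ambient_subfield_axioms assms False)
    have "y \<in> K"
      using splitting_field_subset_K root_in_splitting_field[OF assms(6), of M] assms(7) by auto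
    then show ?thesis
      using moebius_related_or_reflected[OF assms(3,6)] False \<open>x \<in> M \<longleftrightarrow> y \<in> M\<close> by blast
  qed
qed

theorem theorem5p4:
  fixes k M :: "'a::field set" and m n :: 'a
  assumes "algebraic_closure (ring_of_type_algebra :: 'a ring) M"
    and "subfield k (ring_of_type_algebra :: 'a ring)"
    and "CHAR('a) \<noteq> 2"
    and "subfield M (ring_of_type_algebra :: 'a ring)"
    and "k \<subseteq> M"
    and "infinite M"
    and "m \<in> M" and "n \<in> M"
    and "m^2 + 3 * m + 9 \<noteq> 0"
    and "n^2 + 3 * n + 9 \<noteq> 0"
  shows "splitting_field M (simplest_cubic m) = splitting_field M (simplest_cubic n) \<longleftrightarrow>
    (\<exists>z\<in>M. m * z * (z + 1) + z^3 + 3 * z^2 - 1 \<noteq> 0 \<and>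
      (n = (m * (z^3 - 3 * z - 1) - 9 * z * (z + 1)) /
           (m * z * (z + 1) + z^3 + 3 * z^2 - 1) \<or>
       n = - ((m * (z^3 + 3 * z^2 - 1) + 3 * (z^3 - 3 * z - 1)) /
              (m * z * (z + 1) + z^3 + 3 * z^2 - 1))))"
    (is "?eq \<longleftrightarrow> (\<exists>z\<in>M. ?D z \<noteq> 0 \<and> (n = ?N z / ?D z \<or> n = - (?N' z / ?D z)))")
proof -
  obtain x y where x: "poly (simplest_cubic m) x = 0" and y: "poly (simplest_cubic n) y = 0"
    using simplest_cubic_has_root[OF assms(1)] by blast
  have "(- n - 3)^2 + 3 * (- n - 3) + 9 \<noteq> 0"
    using assms(10) by (simp add: power2_eq_square algebra_simps)
  then have "?eq \<longleftrightarrow> moebius_related M m n \<or> moebius_related M m (- n - 3)"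
    using splitting_field_eq_imp_moebius_related[OF assms(4,7,8,9) x y]
      moebius_related_splitting_field[OF assms(4) x] assms(10)
      splitting_field_simplest_cubic_reflect[OF y, of M] by metis
  also have "\<dots> \<longleftrightarrow> (\<exists>z\<in>M. ?D z \<noteq> 0 \<and> (n = ?N z / ?D z \<or> n = - (?N' z / ?D z)))"
  proof -
    have "n = ?N z / ?D z \<longleftrightarrow> n * ?D z = ?N z" if "?D z \<noteq> 0" for z
      using that by (simp add: nonzero_eq_divide_eq)
    \<comment> \<open>Since \<open>?N' z = ?N z + 3 * ?D z\<close>, the second formula is the first
      one for \<open>- n - 3\<close>.\<close>
    moreover have "n = - (?N' z / ?D z) \<longleftrightarrow> (- n - 3) * ?D z = ?N z" if "?D z \<noteq> 0" for z
    proof -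
      have "n = - (?N' z / ?D z) \<longleftrightarrow> n * ?D z + ?N' z = 0"
        unfolding minus_divide_left nonzero_eq_divide_eq[OF that] eq_neg_iff_add_eq_0 ..
      also have "n * ?D z + ?N' z = - ((- n - 3) * ?D z - ?N z)"
        by Groebner_Basis.algebra
      also have "\<dots> = 0 \<longleftrightarrow> (- n - 3) * ?D z = ?N z"
        by (simp only: neg_equal_0_iff_equal right_minus_eq)
      finally show ?thesis .
    qed
    ultimately show ?thesis unfolding moebius_related_def by blast
  qed
  finally show ?thesis .
qed

end
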